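(* Let $G=G_n$ be a connected almost regular graph on $n$ vertices with minimum degree $\Omega(\log n)$; that is, there are constants $c>0$ and $C\ge 1$, independent of $n$, such that the minimum degree $\delta$ and the maximum degree $\Delta$ of $G_n$ satisfy $\delta\ge c\log n$ and $\Delta\le C\delta$. Then, as $n\to\infty$, the maximum load after $n$ balls are allocated to the vertices of $G_n$ by the local search allocation (with ties broken uniformly at random) is $O(1)$ with probability $1-o(1)$; that is, there is a constant $K$ independent of $n$ such that $\Pr[X_{\max}^{(n)}\le K]\to 1$ as $n\to\infty$.
   Context: Local search allocation on a finite, undirected, connected graph $G=(V,E)$ with $|V|=n$: the vertices are bins, all initially with load $0$. Balls $1,2,\dots$ are allocated one after another. Ball $i$ is born at a vertex $U_i$ (its birthplace), where $U_1,U_2,\dots$ are independent and uniform on $V$. Starting at $U_i$, as long as the current vertex has a neighbor whose load is strictly smaller than the load of the current vertex, the ball moves to a neighbor of smallest load; ties among the neighbors of smallest load are broken uniformly at random, independently. The search stops at the first vertex none of whose neighbors has a smaller load (a local minimum); the ball is placed there and the load of that vertex increases by $1$. $X_v^{(i)}$ is the load of $v$ right after ball $i$ is placed, and $X_{\max}^{(n)}=\max_{v\in V}X_v^{(n)}$. *)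

theory Defs
  imports "HOL-Probability.Probability" "Graph_Theory.Graph_Theory"
begin

text \<open>
  A finite simple undirected graph is a digraph satisfying the locale predicate \<open>graph\<close> (finite,
  loop-free, no parallel arcs, symmetric), so an undirected edge is a pair of opposite arcs and the
  degree of a vertex is its \<open>out_degree\<close>.
\<close>

definition min_degree :: "('a, 'b) pre_digraph \<Rightarrow> nat" where
  "min_degree G = Min (out_degree G ` verts G)"

definition max_degree :: "('a, 'b) pre_digraph \<Rightarrow> nat" where
  "max_degree G = Max (out_degree G ` verts G)"

definition neighbors :: "('a, 'b) pre_digraph \<Rightarrow> 'a \<Rightarrow> 'a set" where
  "neighbors G v = {u. v \<rightarrow>\<^bsub>G\<^esub> u}"

definition least_loaded_neighbors :: "('a, 'b) pre_digraph \<Rightarrow> ('a \<Rightarrow> nat) \<Rightarrow> 'a \<Rightarrow> 'a set" where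
  "least_loaded_neighbors G X v = {u \<in> neighbors G v. \<forall>w \<in> neighbors G v. X u \<le> X w}"

text \<open>
  Law of the final vertex of a local search started at \<open>v\<close> when the loads are \<open>X\<close>. The
  finiteness test is always true in a finite graph; it is there because \<open>pmf_of_set\<close> is
  unspecified on infinite sets, which would spoil the termination proof.
\<close>

function local_search :: "('a, 'b) pre_digraph \<Rightarrow> ('a \<Rightarrow> nat) \<Rightarrow> 'a \<Rightarrow> 'a pmf" where
  "local_search G X v =
     (if finite (neighbors G v) \<and> (\<exists>u \<in> neighbors G v. X u < X v)
      then bind_pmf (pmf_of_set (least_loaded_neighbors G X v)) (\<lambda>u. local_search G X u)
      else return_pmf v)"
  by pat_completeness auto

termination
proof (relation "Wellfounded.measure (\<lambda>(G, X, v). X v)", goal_cases)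
  case 1
  show ?case by simp
next
  case (2 G X v u)
  let ?N = "neighbors G v"
  from 2 obtain w where fin: "finite ?N" and w: "w \<in> ?N" "X w < X v" by blast
  obtain m where "m \<in> ?N" "\<forall>x \<in> ?N. X m \<le> X x"
    using ex_is_arg_min_if_finite[of ?N X] fin w by (auto simp: is_arg_min_linorder)
  then have "least_loaded_neighbors G X v \<noteq> {}" "finite (least_loaded_neighbors G X v)"
    using fin by (auto simp: least_loaded_neighbors_def)
  then have "u \<in> least_loaded_neighbors G X v"
    using 2 by (simp add: set_pmf_of_set)
  then have "X u \<le> X w"
    using w by (auto simp: least_loaded_neighbors_def)
  then show ?case using w by simp
qed

declare local_search.simps [simp del]

text \<open>
  Joint law of the load vector after \<open>i\<close> balls. Successive uses of \<open>bind_pmf\<close> draw each birthplace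
  (and each tie-break inside the search) independently of everything drawn before.
\<close>

primrec load_pmf :: "('a, 'b) pre_digraph \<Rightarrow> nat \<Rightarrow> ('a \<Rightarrow> nat) pmf" where
  "load_pmf G 0 = return_pmf (\<lambda>v. 0)"
| "load_pmf G (Suc i) =
     do { X \<leftarrow> load_pmf G i;
          u \<leftarrow> pmf_of_set (verts G);
          v \<leftarrow> local_search G X u;
          return_pmf (X(v := Suc (X v))) }"

definition max_load :: "('a, 'b) pre_digraph \<Rightarrow> ('a \<Rightarrow> nat) \<Rightarrow> nat" where
  "max_load G X = Max (X ` verts G)"

end

theory Submission
  imports Defs
begin

text \<open>
  The allocation is monotone in the initial loads: a search in a pointwise larger, 1-Lipschitz load
  vector can be coupled so that domination survives the new ball. So the \<open>n\<close> balls may be split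
  into constantly many phases of a small linear number of balls, and before each phase the loads may
  be raised to a flat vector; it remains to show that a phase increases a flat vector by at most
  one. As long as every vertex has at least half the minimum degree many neighbors at the flat
  level, a search moves at most once, to a uniformly random one of these, so that a neighborhood is
  hit with probability \<open>O(\<Delta> / n)\<close>. The expected number of raised neighbors of a vertex is thus a
  small fraction of its degree \<open>\<Omega>(log n)\<close>, and an exponential moment bound beats the union bound
  over all vertices.
\<close>

section \<open>Couplings and two-stage probabilities\<close>

lemma rel_pmf_if_all:
  assumes "\<And>x y. x \<in> set_pmf p \<Longrightarrow> y \<in> set_pmf q \<Longrightarrow> R x y"
  shows "rel_pmf R p q"
  by (rule rel_pmf.intros[where pq = "pair_pmf p q"])
    (use assms in \<open>auto simp: map_fst_pair_pmf map_snd_pair_pmf\<close>)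

text \<open>Draw \<open>z\<close> from \<open>M\<close>, keep it if it lies in \<open>M'\<close>,
  and otherwise redraw uniformly from \<open>M'\<close>; by symmetry the result is uniform on
  \<open>M'\<close>. This will couple the tie-breaks of two searches when one has fewer candidates
  than the other.\<close>

lemma rel_pmf_of_set_subset:
  assumes M: "finite M" and sub: "M' \<subseteq> M" and ne: "M' \<noteq> {}"
  shows "rel_pmf (\<lambda>z z'. z \<in> M \<and> z' \<in> M' \<and> (z = z' \<or> z \<notin> M')) (pmf_of_set M) (pmf_of_set M')"
proof -
  have M': "finite M'" and neM: "M \<noteq> {}" using assms finite_subset by auto
  define g where "g z = (if z \<in> M' then return_pmf z else pmf_of_set M')" for z
  have "pmf (bind_pmf (pmf_of_set M) g) y = pmf (pmf_of_set M') y" for y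
  proof -
    have "(\<Sum>z\<in>M. pmf (g z) y) = (\<Sum>z\<in>M'. pmf (g z) y) + (\<Sum>z\<in>M - M'. pmf (g z) y)"
      using M sub by (metis add.commute sum.subset_diff)
    also have "(\<Sum>z\<in>M'. pmf (g z) y) = indicator M' y"
      using M' by (simp add: g_def indicator_def sum.If_cases)
    also have "(\<Sum>z\<in>M - M'. pmf (g z) y) = (\<Sum>z\<in>M - M'. pmf (pmf_of_set M') y)"
      by (intro sum.cong) (auto simp: g_def)
    also have "\<dots> = (real (card M) - real (card M')) * (indicator M' y / real (card M'))"
      using M M' sub ne by (simp add: card_Diff_subset card_mono of_nat_diff)
    also have "indicator M' y + \<dots> = real (card M) * (indicator M' y / real (card M'))"
      using M' ne by (simp add: field_simps)
    finally show ?thesis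
      using M M' ne neM by (simp add: pmf_bind_pmf_of_set)
  qed
  then have eq: "pmf_of_set M' = bind_pmf (pmf_of_set M) g"
    by (intro pmf_eqI) simp
  have "rel_pmf (\<lambda>z z'. z \<in> M \<and> z' \<in> M' \<and> (z = z' \<or> z \<notin> M'))
      (bind_pmf (pmf_of_set M) return_pmf) (bind_pmf (pmf_of_set M) g)"
  proof (rule rel_pmf_bindI)
    show "rel_pmf (\<lambda>x y. x = y \<and> x \<in> M) (pmf_of_set M) (pmf_of_set M)"
      using M neM by (intro rel_pmf_reflI) auto
  qed (use M' ne in \<open>auto simp: g_def rel_pmf_return_pmf1\<close>)
  then show ?thesis by (simp add: eq bind_return_pmf')
qed

lemma measure_bind_pmf:
  "measure (bind_pmf p f) A = (\<integral>x. measure (f x) A \<partial>measure_pmf p)"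
proof -
  have "ennreal (measure (bind_pmf p f) A) = (\<integral>\<^sup>+x. ennreal (measure (f x) A) \<partial>measure_pmf p)"
    using emeasure_bind_pmf[of p f A] by (simp add: measure_pmf.emeasure_eq_measure)
  also have "\<dots> = ennreal (\<integral>x. measure (f x) A \<partial>measure_pmf p)"
    by (intro nn_integral_eq_integral measure_pmf.integrable_const_bound[where B = 1]) auto
  finally show ?thesis
    by (simp add: integral_nonneg)
qed

text \<open>Chains two phases: \<open>B\<close> collects the bad outcomes of the first one, and
  \<open>e\<close> bounds the failure of the second after a good one.\<close>

lemma measure_bind_pmf_le:
  fixes f :: "'a \<Rightarrow> 'b pmf"
  assumes "\<And>x. x \<in> set_pmf p \<Longrightarrow> x \<notin> B \<Longrightarrow> measure (f x) A \<le> e" and "0 \<le> e"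
  shows "measure (bind_pmf p f) A \<le> measure p B + e"
proof -
  have "measure (f x) A \<le> indicator B x + e" if "x \<in> set_pmf p" for x
    using assms that by (cases "x \<in> B") (auto intro: add_increasing2)
  moreover have "integrable p (\<lambda>x. measure (f x) A)" "integrable p (indicator B :: 'a \<Rightarrow> real)"
    by (auto intro!: measure_pmf.integrable_const_bound[where B = 1])
  ultimately have "(\<integral>x. measure (f x) A \<partial>measure_pmf p) \<le> (\<integral>x. indicator B x + e \<partial>measure_pmf p)"
    by (intro integral_mono_AE Bochner_Integration.integrable_add) (auto simp: AE_measure_pmf_iff)
  also have "\<dots> = measure p B + e"
    using \<open>integrable p (indicator B)\<close> by simp
  finally have "(\<integral>x. measure (f x) A \<partial>measure_pmf p) \<le> measure p B + e" .
  then show ?thesis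
    by (simp add: measure_bind_pmf)
qed

lemma rel_pmf_measure_mono:
  fixes p :: "'a pmf" and q :: "'b pmf"
  assumes "rel_pmf R p q" and "\<And>x y. R x y \<Longrightarrow> x \<in> A \<Longrightarrow> y \<in> B"
  shows "measure p A \<le> measure q B"
proof -
  have "measure p A \<le> measure q {y. \<exists>x\<in>A. R x y}"
    using assms(1) by (rule rel_pmf_measureD)
  also have "\<dots> \<le> measure q B"
    using assms(2) by (intro measure_pmf.finite_measure_mono) auto
  finally show ?thesis .
qed

section \<open>The process from an arbitrary load vector\<close>

text \<open>Peels off the first ball, whereas \<open>load_pmf\<close> appends the last one.
  Inductions over the number of balls can thus generalize the starting vector, as the coupling and
  the potential argument require.\<close>

primrec load_steps :: "('a, 'b) pre_digraph \<Rightarrow> nat \<Rightarrow> ('a \<Rightarrow> nat) \<Rightarrow> ('a \<Rightarrow> nat) pmf" where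
  "load_steps G 0 X = return_pmf X"
| "load_steps G (Suc i) X =
     do { v \<leftarrow> bind_pmf (pmf_of_set (verts G)) (local_search G X);
          load_steps G i (X(v := Suc (X v))) }"

lemma load_steps_Suc_right:
  "load_steps G (Suc i) X =
     do { Y \<leftarrow> load_steps G i X;
          v \<leftarrow> bind_pmf (pmf_of_set (verts G)) (local_search G Y);
          return_pmf (Y(v := Suc (Y v))) }"
proof (induction i arbitrary: X)
  case 0
  show ?case by (simp only: load_steps.simps bind_return_pmf)
next
  case (Suc i)
  show ?case
    by (subst load_steps.simps(2), subst Suc.IH) (simp add: bind_assoc_pmf)
qed

text \<open>The Markov property that cuts the process into phases.\<close>

lemma load_pmf_add: "load_pmf G (i + j) = bind_pmf (load_pmf G i) (load_steps G j)"
proof (induction j)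
  case 0
  then show ?case by (simp add: bind_return_pmf')
next
  case (Suc j)
  then show ?case
    by (simp add: load_steps_Suc_right bind_assoc_pmf del: load_steps.simps)
qed

section \<open>Neighborhoods and the course of a search\<close>

context graph
begin

lemma finite_neighbors [simp]: "finite (neighbors G v)"
  by (rule finite_subset[OF _ finite_verts])
    (auto simp: neighbors_def arcs_ends_def arc_to_ends_def)

lemma neighbors_subset_verts: "neighbors G v \<subseteq> verts G"
  by (auto simp: neighbors_def arcs_ends_def arc_to_ends_def)

lemma neighbors_sym: "u \<in> neighbors G v \<longleftrightarrow> v \<in> neighbors G u"
  using arcs_ends_symmetric[OF sym_arcs] by (auto simp: neighbors_def)

lemma card_neighbors: "card (neighbors G v) = out_degree G v"
proof -
  have "neighbors G v = head G ` out_arcs G v"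
    by (auto simp: neighbors_def arcs_ends_def arc_to_ends_def)
  moreover have "inj_on (head G) (out_arcs G v)"
    by (auto intro!: inj_onI no_multi_arcs simp: arc_to_ends_def)
  ultimately show ?thesis by (simp add: card_image out_degree_def)
qed

lemma local_search_stop:
  assumes "\<And>u. u \<in> neighbors G v \<Longrightarrow> X v \<le> X u"
  shows "local_search G X v = return_pmf v"
proof -
  have "\<not> (\<exists>u \<in> neighbors G v. X u < X v)"
    using assms by (meson leD)
  then show ?thesis
    by (subst local_search.simps) simp
qed

lemma local_search_move:
  "u \<in> neighbors G v \<Longrightarrow> X u < X v \<Longrightarrow>
    local_search G X v = bind_pmf (pmf_of_set (least_loaded_neighbors G X v)) (local_search G X)"
  by (subst local_search.simps) auto

lemma finite_least_loaded_neighbors [simp]: "finite (least_loaded_neighbors G X v)"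
  by (simp add: least_loaded_neighbors_def)

lemma least_loaded_neighbors_nonempty:
  assumes "u \<in> neighbors G v"
  shows "least_loaded_neighbors G X v \<noteq> {}"
  using ex_is_arg_min_if_finite[of "neighbors G v" X] assms
  by (auto simp: is_arg_min_linorder least_loaded_neighbors_def)

text \<open>Every move strictly lowers the load, so induction on \<open>X v\<close> reaches all
  least loaded neighbors at once, whichever way the tie is broken.\<close>

lemma local_search_induct [case_names stop move]:
  assumes stop: "\<And>v. (\<And>u. u \<in> neighbors G v \<Longrightarrow> X v \<le> X u) \<Longrightarrow> P v"
    and move: "\<And>v u. u \<in> neighbors G v \<Longrightarrow> X u < X v \<Longrightarrow>
      (\<And>z. z \<in> least_loaded_neighbors G X v \<Longrightarrow> X z < X v) \<Longrightarrow>
      (\<And>z. z \<in> least_loaded_neighbors G X v \<Longrightarrow> P z) \<Longrightarrow> P v"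
  shows "P v"
proof (induction "X v" arbitrary: v rule: less_induct)
  case less
  show ?case
  proof (cases "\<exists>u \<in> neighbors G v. X u < X v")
    case True
    then obtain u where u: "u \<in> neighbors G v" "X u < X v" by blast
    then have "X z < X v" if "z \<in> least_loaded_neighbors G X v" for z
      using that by (force simp: least_loaded_neighbors_def)
    then show ?thesis using move[OF u] less by blast
  qed (auto intro: stop simp: not_less)
qed

lemma set_local_search:
  "w \<in> set_pmf (local_search G X v) \<Longrightarrow>
    (w = v \<or> w \<in> verts G) \<and> (w = v \<or> X w < X v) \<and> (\<forall>u \<in> neighbors G w. X w \<le> X u)"
proof (induction v rule: local_search_induct[where X = X])
  case (stop v)
  then show ?case by (auto simp: local_search_stop)
next
  case (move v u)
  then obtain z where z: "z \<in> least_loaded_neighbors G X v" "w \<in> set_pmf (local_search G X z)"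
    using least_loaded_neighbors_nonempty[OF move(1)] by (auto simp: local_search_move)
  then have "z \<in> verts G"
    using neighbors_subset_verts by (auto simp: least_loaded_neighbors_def)
  then show ?case using move(3,4)[OF z(1)] z by fastforce
qed

section \<open>Monotone coupling\<close>

text \<open>One inequality suffices: adjacency is symmetric, so loads of adjacent vertices differ by
  at most one.\<close>

definition lipschitz_load :: "('a \<Rightarrow> nat) \<Rightarrow> bool" where
  "lipschitz_load X \<longleftrightarrow> (\<forall>v. \<forall>u \<in> neighbors G v. X v \<le> Suc (X u))"

text \<open>A ball is placed at a local minimum \<open>w\<close>, so the new load there exceeds that
  of a neighbor by at most one.\<close>

lemma lipschitz_load_update:
  assumes "lipschitz_load X" and "\<And>u. u \<in> neighbors G w \<Longrightarrow> X w \<le> X u"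
  shows "lipschitz_load (X(w := Suc (X w)))"
  using assms by (auto simp: lipschitz_load_def intro: le_SucI)

text \<open>
  The two searches stay together until the upper one is strictly higher at the current vertex of
  the lower one. From then on the lower search remains strictly below, because each of its moves
  lowers its load by at least one while the upper load drops by at most one along an edge.
\<close>

lemma set_local_search_strict:
  assumes "lipschitz_load X'" and "X v < X' v" and "w \<in> set_pmf (local_search G X v)"
  shows "X w < X' w"
  using assms(2,3)
proof (induction v rule: local_search_induct[where X = X])
  case (stop v)
  then show ?case by (auto simp: local_search_stop)
next
  case (move v u)
  then obtain z where z: "z \<in> least_loaded_neighbors G X v" "w \<in> set_pmf (local_search G X z)"
    using least_loaded_neighbors_nonempty[OF move(1)] by (auto simp: local_search_move)
  then have "X' v \<le> Suc (X' z)"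
    using assms(1) by (auto simp: lipschitz_load_def least_loaded_neighbors_def)
  then have "X z < X' z" using move(3)[OF z(1)] \<open>X v < X' v\<close> by simp
  then show ?case using move(4)[OF z(1)] z(2) by simp
qed

text \<open>The relation between the endpoints is what keeps domination: either the lower ball fills
  a strict gap, or both balls land on the same vertex.\<close>

lemma local_search_coupling:
  assumes le: "\<And>v. X v \<le> X' v" and lip: "lipschitz_load X'"
  shows "rel_pmf (\<lambda>w w'. X w < X' w \<or> w = w') (local_search G X v) (local_search G X' v)"
proof (induction v rule: local_search_induct[where X = X])
  case (stop v)
  show ?case
  proof (cases "X v < X' v")
    case True
    then show ?thesis using stop by (auto simp: local_search_stop rel_pmf_return_pmf1)
  next
    case False
    then have "X' v \<le> X' u" if "u \<in> neighbors G v" for u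
      using stop[OF that] le[of u] by simp
    then show ?thesis using stop by (simp add: local_search_stop)
  qed
next
  case (move v u)
  let ?M = "least_loaded_neighbors G X v" and ?M' = "least_loaded_neighbors G X' v"
  let ?R = "\<lambda>w w'. X w < X' w \<or> w = w'"
  \<comment> \<open>If the lower search is certain to end at a strict gap, the upper endpoint is
    irrelevant and independent searches do.\<close>
  have strict: ?case if "\<And>w. w \<in> set_pmf (local_search G X v) \<Longrightarrow> X w < X' w"
    using that by (intro rel_pmf_if_all) simp
  show ?case
  proof (cases "X v < X' v \<or> (\<forall>z \<in> ?M. X z < X' z)")
    case True
    then show ?thesis
    proof (intro strict)
      fix w assume w: "w \<in> set_pmf (local_search G X v)"
      then obtain z where z: "z \<in> ?M" "w \<in> set_pmf (local_search G X z)"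
        using least_loaded_neighbors_nonempty[OF move(1)]
        by (auto simp: local_search_move[OF move(1,2)])
      show "X w < X' w"
        using True set_local_search_strict[OF lip _ w] set_local_search_strict[OF lip _ z(2)] z(1)
        by auto
    qed
  next
    case False
    then obtain y where y: "y \<in> ?M" "X y = X' y" and v: "X v = X' v"
      using le by (metis le_neq_implies_less)
    have yv: "y \<in> neighbors G v"
      using y(1) by (simp add: least_loaded_neighbors_def)
    have yv': "X' y < X' v"
      using move(3)[OF y(1)] y(2) v by linarith
    have least: "X y \<le> X z" if "z \<in> neighbors G v" for z
      using y that by (auto simp: least_loaded_neighbors_def)
    \<comment> \<open>Among the neighbors of \<open>v\<close>, \<open>X'\<close> is at least
      \<open>X\<close>, hence at least \<open>X y = X' y\<close>. So both minima coincide, and the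
      upper minimizers are the lower ones where the two vectors agree.\<close>
    have M': "?M' = {z \<in> ?M. X' z = X z}"
    proof (intro equalityI subsetI)
      fix z assume z: "z \<in> ?M'"
      then have "z \<in> neighbors G v" "X' z \<le> X' y"
        using yv by (simp_all add: least_loaded_neighbors_def)
      then have "X z = X y" "X' z = X z"
        using least[of z] le[of z] y by auto
      then show "z \<in> {z \<in> ?M. X' z = X z}"
        using z y by (auto simp: least_loaded_neighbors_def)
    next
      fix z assume z: "z \<in> {z \<in> ?M. X' z = X z}"
      show "z \<in> ?M'"
        unfolding least_loaded_neighbors_def
      proof (intro CollectI conjI ballI)
        show "z \<in> neighbors G v" using z by (auto simp: least_loaded_neighbors_def)
        fix w assume "w \<in> neighbors G v"
        then have "X z \<le> X w" using z by (simp add: least_loaded_neighbors_def)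
        then show "X' z \<le> X' w" using z le[of w] by simp
      qed
    qed
    have "rel_pmf ?R (bind_pmf (pmf_of_set ?M) (local_search G X))
        (bind_pmf (pmf_of_set ?M') (local_search G X'))"
    proof (rule rel_pmf_bindI)
      show "rel_pmf (\<lambda>z z'. z \<in> ?M \<and> z' \<in> ?M' \<and> (z = z' \<or> z \<notin> ?M'))
          (pmf_of_set ?M) (pmf_of_set ?M')"
        using M' y by (intro rel_pmf_of_set_subset) auto
    next
      fix z z' assume z: "z \<in> ?M \<and> z' \<in> ?M' \<and> (z = z' \<or> z \<notin> ?M')"
      show "rel_pmf ?R (local_search G X z) (local_search G X' z')"
      proof (cases "z = z'")
        case True
        then show ?thesis using move(4)[of z] z by simp
      next
        case False
        \<comment> \<open>A redrawn \<open>z\<close> is a lower minimizer outside \<open>M'\<close>,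
          so the lower search has just entered a strict gap and stays in one.\<close>
        then have "X' z \<noteq> X z" using z M' by blast
        then have "X z < X' z" using le[of z] by simp
        then show ?thesis
          by (auto intro!: rel_pmf_if_all dest: set_local_search_strict[OF lip])
      qed
    qed
    then show ?thesis
      by (simp only: local_search_move[OF move(1,2)] local_search_move[of y, OF yv yv'])
  qed
qed

lemma load_steps_coupling:
  assumes "X \<le> X'" and "lipschitz_load X'"
  shows "rel_pmf (\<le>) (load_steps G i X) (load_steps G i X')"
  using assms
proof (induction i arbitrary: X X')
  case (Suc i)
  \<comment> \<open>The second conjunct records that the upper ball lands at a local minimum, which
    preserves \<open>lipschitz_load\<close> for the next step.\<close>
  let ?R = "\<lambda>w w'. (X w < X' w \<or> w = w') \<and> (\<forall>u \<in> neighbors G w'. X' w' \<le> X' u)"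
  have search: "rel_pmf ?R (local_search G X v) (local_search G X' v)" for v
    by (rule pmf.rel_mono_strong[OF local_search_coupling[of X X']])
      (use Suc.prems in \<open>auto simp: le_fun_def dest: set_local_search\<close>)
  have "rel_pmf ?R (bind_pmf (pmf_of_set (verts G)) (local_search G X))
      (bind_pmf (pmf_of_set (verts G)) (local_search G X'))"
    by (rule rel_pmf_bindI[where R = "(=)"]) (auto intro: search rel_pmf_reflI)
  then show ?case
    unfolding load_steps.simps
  proof (rule rel_pmf_bindI)
    fix w w' assume R: "?R w w'"
    then have le: "X(w := Suc (X w)) \<le> X'(w' := Suc (X' w'))"
      using Suc.prems(1) by (auto simp: le_fun_def le_SucI)
    then show "rel_pmf (\<le>) (load_steps G i (X(w := Suc (X w)))) (load_steps G i (X'(w' := Suc (X' w'))))"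
      using R by (intro Suc.IH[OF le] lipschitz_load_update[OF Suc.prems(2)]) blast
  qed
qed simp

end

section \<open>One ball on a sparse two-level vector\<close>

locale bounded_degree_graph = graph +
  fixes d D :: nat
  assumes d_pos: "0 < d" and verts_nonempty: "verts G \<noteq> {}"
    and le_degree: "\<And>u. u \<in> verts G \<Longrightarrow> d \<le> card (neighbors G u)"
    and degree_le: "\<And>u. u \<in> verts G \<Longrightarrow> card (neighbors G u) \<le> D"
begin

abbreviation landing :: "('a \<Rightarrow> nat) \<Rightarrow> 'a pmf" where
  "landing X \<equiv> bind_pmf (pmf_of_set (verts G)) (local_search G X)"

definition raised :: "nat \<Rightarrow> ('a \<Rightarrow> nat) \<Rightarrow> 'a \<Rightarrow> 'a set" where
  "raised j X u = {w \<in> neighbors G u. X w \<noteq> j}"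

definition two_level :: "nat \<Rightarrow> ('a \<Rightarrow> nat) \<Rightarrow> bool" where
  "two_level j X \<longleftrightarrow> (\<forall>v. X v = j \<or> X v = Suc j)"

definition sparse :: "nat \<Rightarrow> ('a \<Rightarrow> nat) \<Rightarrow> bool" where
  "sparse j X \<longleftrightarrow> (\<forall>u \<in> verts G. 2 * card (raised j X u) \<le> d)"

lemma card_low_neighbors:
  assumes "sparse j X" and "u \<in> verts G"
  shows "d \<le> 2 * card {w \<in> neighbors G u. X w = j}"
proof -
  have "neighbors G u = raised j X u \<union> {w \<in> neighbors G u. X w = j}"
    by (auto simp: raised_def)
  then have "card (neighbors G u) \<le> card (raised j X u) + card {w \<in> neighbors G u. X w = j}"
    by (metis card_Un_le)
  then show ?thesis
    using assms le_degree[of u] by (auto simp: sparse_def)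
qed

text \<open>Level \<open>j\<close> is the global minimum, so a search stops there at once. From
  level \<open>Suc j\<close>, sparsity provides a neighbor at level \<open>j\<close>, and the search
  stops after one move.\<close>

lemma local_search_two_level:
  assumes X: "two_level j X" and sparse: "sparse j X" and u: "u \<in> verts G"
  shows "local_search G X u =
    (if X u = j then return_pmf u else pmf_of_set {w \<in> neighbors G u. X w = j})"
proof -
  have stop: "local_search G X w = return_pmf w" if "X w = j" for w
    using X that by (intro local_search_stop) (metis eq_refl le_SucI two_level_def)
  let ?L = "{w \<in> neighbors G u. X w = j}"
  have "?L \<noteq> {}"
    using card_low_neighbors[OF sparse u] d_pos by (metis card.empty mult_0_right not_le)
  moreover have "local_search G X u = pmf_of_set ?L" if "X u \<noteq> j"
  proof -
    obtain w where w: "w \<in> neighbors G u" "X w = j"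
      using \<open>?L \<noteq> {}\<close> by blast
    have ge: "j \<le> X v" for v
      using X unfolding two_level_def by (metis eq_refl le_SucI)
    have "X w < X u"
      using ge[of u] that w by simp
    moreover have "least_loaded_neighbors G X u = ?L"
    proof (intro equalityI subsetI)
      fix z assume "z \<in> least_loaded_neighbors G X u"
      then have "z \<in> neighbors G u" "X z \<le> j"
        using w by (auto simp: least_loaded_neighbors_def)
      then show "z \<in> ?L" using ge[of z] by simp
    qed (auto simp: least_loaded_neighbors_def ge)
    ultimately have "local_search G X u = bind_pmf (pmf_of_set ?L) (local_search G X)"
      using w by (simp add: local_search_move)
    also have "\<dots> = bind_pmf (pmf_of_set ?L) return_pmf"
      using \<open>?L \<noteq> {}\<close> by (intro bind_pmf_cong) (auto intro: stop)
    finally show ?thesis by (simp add: bind_return_pmf')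
  qed
  ultimately show ?thesis using stop by simp
qed

lemma measure_local_search_le:
  assumes "two_level j X" and "sparse j X" and u: "u \<in> verts G"
  shows "measure_pmf.prob (local_search G X u) A \<le> indicator A u + 2 / real d * card (neighbors G u \<inter> A)"
proof (cases "X u = j")
  case True
  then show ?thesis
    using assms by (simp add: local_search_two_level measure_return_pmf)
next
  case False
  let ?L = "{w \<in> neighbors G u. X w = j}"
  have L: "real d \<le> 2 * real (card ?L)"
    using card_low_neighbors[OF assms(2) u] by linarith
  then have pos: "0 < card ?L" using d_pos by linarith
  have "measure_pmf.prob (local_search G X u) A = card (?L \<inter> A) / card ?L"
    using False assms pos
    by (simp add: local_search_two_level measure_pmf_of_set card_gt_0_iff)
  also have "\<dots> \<le> card (neighbors G u \<inter> A) / (d / 2)"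
    using L pos d_pos by (intro frac_le) (auto intro!: card_mono)
  also have "\<dots> \<le> indicator A u + 2 / real d * card (neighbors G u \<inter> A)"
    by (simp add: mult.commute)
  finally show ?thesis .
qed

text \<open>Double counting of the paths of length two that end in \<open>x\<close>, by their middle
  vertex \<open>w\<close>.\<close>

lemma sum_common_neighbors_le:
  assumes "x \<in> verts G"
  shows "(\<Sum>u\<in>verts G. card (neighbors G u \<inter> neighbors G x)) \<le> D * D"
proof -
  have "(\<Sum>u\<in>verts G. card (neighbors G u \<inter> neighbors G x))
      = (\<Sum>u\<in>verts G. \<Sum>w\<in>neighbors G x. of_bool (w \<in> neighbors G u))"
    by (simp add: Int_commute sum.If_cases of_bool_def Int_def)
  also have "\<dots> = (\<Sum>w\<in>neighbors G x. \<Sum>u\<in>verts G. of_bool (w \<in> neighbors G u))"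
    by (rule sum.swap)
  also have "\<dots> = (\<Sum>w\<in>neighbors G x. card (neighbors G w))"
  proof (rule sum.cong[OF refl])
    fix w
    have "verts G \<inter> {u. w \<in> neighbors G u} = neighbors G w"
      using neighbors_sym neighbors_subset_verts by blast
    then show "(\<Sum>u\<in>verts G. of_bool (w \<in> neighbors G u)) = card (neighbors G w)"
      by (simp add: sum.If_cases of_bool_def)
  qed
  also have "\<dots> \<le> card (neighbors G x) * D"
    using neighbors_subset_verts degree_le sum_bounded_above[of "neighbors G x" "\<lambda>w. card (neighbors G w)" D]
    by fastforce
  also have "\<dots> \<le> D * D"
    using degree_le[OF assms] by simp
  finally show ?thesis .
qed

text \<open>
  A ball lands in a given neighborhood either because it is born there, or by one move from one of
  at most \<open>D * D\<close> (vertex, neighbor) pairs, taken with probability at most \<open>2 / d\<close>.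
\<close>

definition hit_bound :: real where
  "hit_bound = real D / real (card (verts G)) * (1 + 2 * real D / real d)"

lemma measure_landing_neighbors_le:
  assumes "two_level j X" and "sparse j X" and x: "x \<in> verts G"
  shows "measure_pmf.prob (landing X) (neighbors G x) \<le> hit_bound"
proof -
  let ?n = "real (card (verts G))"
  have indicator: "(\<Sum>u\<in>verts G. indicator (neighbors G x) u) = real (card (neighbors G x))"
    using neighbors_subset_verts[of x] by (simp add: indicator_def sum.If_cases Int_absorb1)
  have "measure_pmf.prob (landing X) (neighbors G x)
      = (\<Sum>u\<in>verts G. measure_pmf.prob (local_search G X u) (neighbors G x)) / ?n"
    using verts_nonempty by (simp add: measure_bind_pmf integral_pmf_of_set)
  also have "\<dots> \<le> (\<Sum>u\<in>verts G. indicator (neighbors G x) u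
      + 2 / real d * card (neighbors G u \<inter> neighbors G x)) / ?n"
    using assms by (intro divide_right_mono sum_mono measure_local_search_le) auto
  also have "\<dots> = (card (neighbors G x)
      + 2 / real d * real (\<Sum>u\<in>verts G. card (neighbors G u \<inter> neighbors G x))) / ?n"
    by (simp add: sum.distrib sum_distrib_left indicator)
  also have "\<dots> \<le> (D + 2 / real d * real (D * D)) / ?n"
    using degree_le[OF x] sum_common_neighbors_le[OF x]
    by (intro divide_right_mono add_mono mult_left_mono) (auto simp flip: of_nat_sum of_nat_mult)
  also have "\<dots> = hit_bound"
    by (simp add: hit_bound_def field_simps)
  finally show ?thesis .
qed

section \<open>Exponential moments within a phase\<close>

text \<open>Summing over all vertices builds in the union bound. The factor 2 matches the threshold
  \<open>d / 2\<close> of \<open>sparse\<close>.\<close>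

definition potential :: "real \<Rightarrow> nat \<Rightarrow> ('a \<Rightarrow> nat) \<Rightarrow> real" where
  "potential s j X = (\<Sum>u\<in>verts G. exp (2 * s * card (raised j X u)))"

lemma potential_nonneg: "0 \<le> potential s j X"
  by (simp add: potential_def sum_nonneg)

lemma set_landing: "set_pmf (landing X) \<subseteq> verts G"
  using verts_nonempty by (auto dest: set_local_search)

lemma integrable_landing: "integrable (measure_pmf (landing X)) (f :: 'a \<Rightarrow> real)"
  by (rule integrable_measure_pmf_finite) (rule finite_subset[OF set_landing finite_verts])

text \<open>A ball at \<open>v\<close> raises at most one further neighbor of \<open>u\<close>, and
  only if \<open>v\<close> is adjacent to \<open>u\<close>. The bound is affine in the indicator, so
  its expectation involves only the probability of hitting the neighborhood.\<close>

lemma potential_update_le: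
  assumes "0 \<le> s"
  shows "potential s j (X(v := Suc (X v)))
    \<le> (\<Sum>u\<in>verts G. exp (2 * s * card (raised j X u)) * (1 + (exp (2 * s) - 1) * indicator (neighbors G u) v))"
  unfolding potential_def
proof (rule sum_mono)
  fix u
  have fin: "finite (raised j X u)" by (simp add: raised_def)
  show "exp (2 * s * card (raised j (X(v := Suc (X v))) u))
      \<le> exp (2 * s * card (raised j X u)) * (1 + (exp (2 * s) - 1) * indicator (neighbors G u) v)"
  proof (cases "v \<in> neighbors G u")
    case True
    have "raised j (X(v := Suc (X v))) u \<subseteq> insert v (raised j X u)"
      by (auto simp: raised_def)
    then have "card (raised j (X(v := Suc (X v))) u) \<le> card (insert v (raised j X u))"
      using fin by (intro card_mono) auto
    also have "\<dots> \<le> Suc (card (raised j X u))"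
      using fin by (simp add: card_insert_if)
    finally have "card (raised j (X(v := Suc (X v))) u) \<le> Suc (card (raised j X u))" .
    then have "2 * s * card (raised j (X(v := Suc (X v))) u) \<le> 2 * s * card (raised j X u) + 2 * s"
      using assms mult_left_mono[of "real (card (raised j (X(v := Suc (X v))) u))"
          "real (card (raised j X u)) + 1" "2 * s"] by (simp add: algebra_simps)
    then show ?thesis using True by (simp flip: exp_add)
  next
    case False
    then have "raised j (X(v := Suc (X v))) u = raised j X u"
      by (auto simp: raised_def)
    then show ?thesis using False by simp
  qed
qed

lemma expected_potential_le:
  assumes "two_level j X" and "sparse j X" and s: "0 \<le> s"
  shows "(\<integral>v. potential s j (X(v := Suc (X v))) \<partial>measure_pmf (landing X))
    \<le> (1 + (exp (2 * s) - 1) * hit_bound) * potential s j X"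
proof -
  have "(\<integral>v. potential s j (X(v := Suc (X v))) \<partial>measure_pmf (landing X))
      \<le> (\<integral>v. (\<Sum>u\<in>verts G. exp (2 * s * card (raised j X u)) *
            (1 + (exp (2 * s) - 1) * indicator (neighbors G u) v)) \<partial>measure_pmf (landing X))"
    by (intro integral_mono integrable_landing potential_update_le s)
  also have "\<dots> = (\<Sum>u\<in>verts G. exp (2 * s * card (raised j X u)) *
      (1 + (exp (2 * s) - 1) * measure_pmf.prob (landing X) (neighbors G u)))"
    by (subst Bochner_Integration.integral_sum)
      (simp_all add: integrable_landing Bochner_Integration.integral_add)
  also have "\<dots> \<le> (\<Sum>u\<in>verts G. exp (2 * s * card (raised j X u)) * (1 + (exp (2 * s) - 1) * hit_bound))"
    using s assms
    by (intro sum_mono mult_left_mono add_left_mono measure_landing_neighbors_le) auto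
  finally show ?thesis
    by (simp add: potential_def sum_distrib_left mult.commute)
qed

lemma hit_bound_nonneg: "0 \<le> hit_bound"
  by (simp add: hit_bound_def)

text \<open>
  A load vector that is not sparse has potential at least \<open>exp (s * d)\<close>, which makes the bound
  trivial. So only sparse vectors matter, and there the potential is almost a supermartingale.
\<close>

lemma load_steps_two_level:
  assumes "two_level j X" and s: "0 \<le> s"
  shows "measure_pmf.prob (load_steps G i X) {Y. \<exists>v. Suc j < Y v}
    \<le> (1 + (exp (2 * s) - 1) * hit_bound) ^ i * potential s j X * exp (- s * d)"
  using assms(1)
proof (induction i arbitrary: X)
  case 0
  then have "X v \<le> Suc j" for v
    by (metis two_level_def eq_refl le_SucI)
  then have "\<not> (\<exists>v. Suc j < X v)" by (simp add: not_less)
  then show ?case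
    by (simp add: measure_return_pmf potential_nonneg)
next
  case (Suc i)
  let ?a = "1 + (exp (2 * s) - 1) * hit_bound"
  let ?B = "{Y. \<exists>v. Suc j < Y v}"
  have a: "1 \<le> ?a" using s hit_bound_nonneg by simp
  show ?case
  proof (cases "sparse j X")
    case True
    \<comment> \<open>On a sparse vector the ball surely lands on level \<open>j\<close>, so two
      levels persist with no probabilistic loss.\<close>
    have level: "two_level j (X(v := Suc (X v)))" if "v \<in> set_pmf (landing X)" for v
    proof -
      have "v \<in> (\<Union>u\<in>verts G. set_pmf (local_search G X u))"
        using that verts_nonempty by simp
      then obtain u where u: "u \<in> verts G" "v \<in> set_pmf (local_search G X u)"
        by blast
      have L: "{w \<in> neighbors G u. X w = j} \<noteq> {}"
        using card_low_neighbors[OF True u(1)] d_pos by (metis card.empty mult_0_right not_le)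
      have "X v = j"
      proof (cases "X u = j")
        case False
        then have "v \<in> set_pmf (pmf_of_set {w \<in> neighbors G u. X w = j})"
          using u(2) local_search_two_level[OF Suc.prems True u(1)] by simp
        then show ?thesis by (subst (asm) set_pmf_of_set[OF L]) auto
      qed (use u(2) local_search_two_level[OF Suc.prems True u(1)] in simp)
      then show ?thesis using Suc.prems by (simp add: two_level_def)
    qed
    have "measure_pmf.prob (load_steps G (Suc i) X) ?B
        = (\<integral>v. measure_pmf.prob (load_steps G i (X(v := Suc (X v)))) ?B \<partial>measure_pmf (landing X))"
      by (simp only: load_steps.simps measure_bind_pmf[of "landing X"])
    also have "\<dots> \<le> (\<integral>v. ?a ^ i * potential s j (X(v := Suc (X v))) * exp (- s * d) \<partial>measure_pmf (landing X))"
      by (intro integral_mono_AE integrable_landing AE_pmfI Suc.IH level)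
    also have "\<dots> = ?a ^ i * (\<integral>v. potential s j (X(v := Suc (X v))) \<partial>measure_pmf (landing X)) * exp (- s * d)"
      by simp
    also have "\<dots> \<le> ?a ^ i * (?a * potential s j X) * exp (- s * d)"
      using a by (intro mult_right_mono mult_left_mono expected_potential_le Suc.prems True s) auto
    finally show ?thesis by (simp add: mult_ac)
  next
    case False
    then obtain u where u: "u \<in> verts G" "d < 2 * card (raised j X u)"
      by (auto simp: sparse_def not_le)
    have "s * d \<le> s * real (2 * card (raised j X u))"
      using s u(2) by (intro mult_left_mono) auto
    then have "exp (s * d) \<le> exp (2 * s * card (raised j X u))"
      by (simp add: mult_ac)
    also have "\<dots> \<le> potential s j X"
      unfolding potential_def using u(1) by (intro member_le_sum) auto
    finally have "1 \<le> potential s j X * exp (- s * d)"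
      by (simp add: exp_minus field_simps)
    then have "1 * 1 \<le> ?a ^ Suc i * (potential s j X * exp (- s * d))"
      using a by (intro mult_mono one_le_power) auto
    then show ?thesis
      by (intro order_trans[OF measure_pmf.prob_le_1]) (simp add: mult_ac)
  qed
qed

lemma load_steps_phase:
  fixes s :: real and m :: nat
  assumes X: "\<And>v. X v \<le> j" and s: "0 \<le> s" and "i \<le> m"
  shows "measure_pmf.prob (load_steps G i X) {Y. \<exists>v. Suc j < Y v}
    \<le> card (verts G) * exp (m * (exp (2 * s) - 1) * hit_bound - s * d)"
proof -
  let ?b = "(exp (2 * s) - 1) * hit_bound"
  have b: "0 \<le> ?b" using s hit_bound_nonneg by simp
  \<comment> \<open>Raising all loads to \<open>j\<close> gives a constant, hence Lipschitz, vector.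
    It has no raised neighbors, so its potential is the number of vertices.\<close>
  have "measure_pmf.prob (load_steps G i X) {Y. \<exists>v. Suc j < Y v}
      \<le> measure_pmf.prob (load_steps G i (\<lambda>_. j)) {Y. \<exists>v. Suc j < Y v}"
    using X by (intro rel_pmf_measure_mono[OF load_steps_coupling])
      (auto simp: le_fun_def lipschitz_load_def intro: less_le_trans)
  also have "\<dots> \<le> (1 + ?b) ^ i * potential s j (\<lambda>_. j) * exp (- s * d)"
    using s by (intro load_steps_two_level) (auto simp: two_level_def)
  also have "potential s j (\<lambda>_. j) = card (verts G)"
    by (simp add: potential_def raised_def)
  also have "(1 + ?b) ^ i * card (verts G) * exp (- s * d)
      \<le> exp (m * ?b) * card (verts G) * exp (- s * d)"
  proof (intro mult_right_mono)
    have "(1 + ?b) ^ i \<le> exp ?b ^ i"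
      using b exp_ge_add_one_self[of ?b] by (intro power_mono) auto
    also have "\<dots> = exp (i * ?b)" by (simp add: exp_of_nat_mult)
    also have "\<dots> \<le> exp (m * ?b)"
      using b \<open>i \<le> m\<close> by (simp add: mult_right_mono)
    finally show "(1 + ?b) ^ i \<le> exp (m * ?b)" .
  qed auto
  also have "\<dots> = card (verts G) * exp (m * (exp (2 * s) - 1) * hit_bound - s * d)"
    by (simp add: exp_diff exp_minus mult_ac divide_inverse)
  finally show ?thesis .
qed

section \<open>Chaining the phases and choosing the constants\<close>

lemma load_pmf_phases:
  fixes s :: real and m :: nat
  assumes s: "0 \<le> s" and "i \<le> k * m"
  shows "measure_pmf.prob (load_pmf G i) {Y. \<exists>v. k < Y v}
    \<le> k * (card (verts G) * exp (m * (exp (2 * s) - 1) * hit_bound - s * d))"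
  using assms(2)
proof (induction k arbitrary: i)
  case 0
  then show ?case by (simp add: measure_return_pmf)
next
  case (Suc k)
  let ?e = "card (verts G) * exp (m * (exp (2 * s) - 1) * hit_bound - s * d)"
  \<comment> \<open>The last phase takes at most \<open>m\<close> balls; if \<open>i\<close> is
    below \<open>m\<close>, it takes them all and the earlier phases are empty.\<close>
  define r where "r = min i m"
  have "i = (i - r) + r" "i - r \<le> k * m" "r \<le> m"
    using Suc.prems by (auto simp: r_def)
  then have "measure_pmf.prob (load_pmf G i) {Y. \<exists>v. Suc k < Y v}
      = measure_pmf.prob (bind_pmf (load_pmf G (i - r)) (load_steps G r)) {Y. \<exists>v. Suc k < Y v}"
    by (metis load_pmf_add)
  also have "\<dots> \<le> measure_pmf.prob (load_pmf G (i - r)) {Y. \<exists>v. k < Y v} + ?e"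
    using \<open>r \<le> m\<close> by (intro measure_bind_pmf_le load_steps_phase s) (auto simp: not_less)
  also have "\<dots> \<le> k * ?e + ?e"
    using Suc.IH[OF \<open>i - r \<le> k * m\<close>] by simp
  finally show ?case by (simp add: algebra_simps)
qed

end

lemma bounded_degree_graphI:
  assumes "graph G" and "verts G \<noteq> {}" and "0 < min_degree G"
  shows "bounded_degree_graph G (min_degree G) (max_degree G)"
proof -
  interpret graph G by fact
  show ?thesis
    by unfold_locales (use assms in \<open>simp_all add: card_neighbors min_degree_def max_degree_def\<close>)
qed

text \<open>With \<open>s = 3 / c\<close>, the growth term in the exponent is at most
  \<open>d / c\<close> and the penalty is \<open>3 * d / c\<close>. The net
  \<open>- 2 * d / c\<close> is at most \<open>- 2 * ln n\<close>, which pays for the factor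
  \<open>n\<close> and leaves \<open>1 / n\<close> per phase.\<close>

lemma prob_max_load_ge:
  fixes c C :: real
  assumes G: "graph G" "card (verts G) = n"
    and c: "0 < c" and C: "1 \<le> C"
    and min: "c * ln n \<le> min_degree G" and max: "max_degree G \<le> C * min_degree G"
    and J: "2 * c * (exp (6 / c) - 1) * C * (1 + 2 * C) \<le> real J" "0 < J"
    and n: "J \<le> n" "2 \<le> n"
  shows "1 - real J / n \<le> measure_pmf.prob (load_pmf G n) {X. max_load G X \<le> J}"
proof -
  let ?d = "min_degree G" and ?D = "max_degree G"
  have V: "finite (verts G)" "verts G \<noteq> {}"
    using G n by (auto intro: card_ge_0_finite)
  have "0 < c * ln n" using c n by simp
  then have d: "0 < real ?d" using min by linarith
  interpret bounded_degree_graph G ?d ?D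
    using G(1) V d by (intro bounded_degree_graphI) auto
  \<comment> \<open>Rounding up lets \<open>J\<close> phases cover all \<open>n\<close> balls, while
    \<open>J \<le> n\<close> keeps \<open>m\<close> within twice \<open>n / J\<close>.\<close>
  define m where "m = n div J + 1"
  have nm: "n \<le> J * m"
    using dividend_less_times_div[OF J(2), of n] by (simp add: m_def)
  have "real (n div J) \<le> n / J" by (rule of_nat_div_le_of_nat)
  moreover have "1 \<le> real n / J" using n J(2) by simp
  ultimately have m: "real m \<le> 2 * n / J" by (simp add: m_def)
  let ?E = "exp (6 / c) - 1"
  have E: "0 \<le> ?E" using c by simp
  have "hit_bound \<le> C * ?d / n * (1 + 2 * C)"
  proof -
    have "real ?D / ?d \<le> C" using max d by (simp add: field_simps)
    then show ?thesis
      unfolding hit_bound_def G(2) using max C d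
      by (intro mult_mono divide_right_mono) auto
  qed
  then have "m * ?E * hit_bound \<le> (2 * n / J) * ?E * (C * ?d / n * (1 + 2 * C))"
    using m E hit_bound_nonneg by (intro mult_mono) auto
  also have "\<dots> = (2 * c * ?E * C * (1 + 2 * C)) * ?d / (c * J)"
    using c n J(2) by (simp add: field_simps)
  \<comment> \<open>The lower bound on \<open>J\<close> is chosen so that it cancels all constants
    except \<open>1 / c\<close>.\<close>
  also have "\<dots> \<le> real J * real ?d / (c * real J)"
    using J c by (intro divide_right_mono mult_right_mono) auto
  also have "\<dots> = ?d / c" using J(2) by simp
  finally have "m * ?E * hit_bound - 3 / c * ?d \<le> - 2 * (?d / c)" by (simp add: field_simps)
  also have "\<dots> \<le> - 2 * ln n"
    using min c by (simp add: field_simps)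
  finally have "exp (m * ?E * hit_bound - 3 / c * ?d) \<le> exp (- 2 * ln n)" by simp
  also have "\<dots> = 1 / (real n * real n)"
    using n by (simp add: exp_minus exp_double power2_eq_square divide_inverse)
  finally have exp: "n * exp (m * ?E * hit_bound - 3 / c * ?d) \<le> 1 / n"
    using n by (simp add: field_simps)
  have "measure_pmf.prob (load_pmf G n) {X. \<exists>v. J < X v}
      \<le> J * (n * exp (m * (exp (2 * (3 / c)) - 1) * hit_bound - 3 / c * ?d))"
    using load_pmf_phases[of "3 / c" n J m] nm c G(2) by simp
  also have "\<dots> \<le> J * (1 / n)"
    using exp by (intro mult_left_mono) auto
  finally have "measure_pmf.prob (load_pmf G n) {X. \<exists>v. J < X v} \<le> J / n" by simp
  moreover have "measure_pmf.prob (load_pmf G n) (UNIV - {X. \<exists>v. J < X v})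
      = 1 - measure_pmf.prob (load_pmf G n) {X. \<exists>v. J < X v}"
    using measure_pmf.prob_compl[of "{X. \<exists>v. J < X v}" "load_pmf G n"] by simp
  \<comment> \<open>Only an inclusion: the event on the left bounds the load at every point of the
    type, \<open>max_load\<close> only at the vertices.\<close>
  moreover have "measure_pmf.prob (load_pmf G n) (UNIV - {X. \<exists>v. J < X v})
      \<le> measure_pmf.prob (load_pmf G n) {X. max_load G X \<le> J}"
    using V by (intro measure_pmf.finite_measure_mono) (auto simp: max_load_def not_less)
  ultimately show ?thesis by linarith
qed

theorem theorem1p4:
  fixes G :: "nat \<Rightarrow> ('a, 'b) pre_digraph" and c C :: real
  assumes "\<And>n. n \<ge> 1 \<Longrightarrow> graph (G n)"
    and "\<And>n. n \<ge> 1 \<Longrightarrow> Digraph_Component.connected (G n)"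
    and "\<And>n. n \<ge> 1 \<Longrightarrow> card (verts (G n)) = n"
    and "c > 0" and "C \<ge> 1"
    and "\<forall>\<^sub>F n in sequentially. real (min_degree (G n)) \<ge> c * ln (real n)"
    and "\<forall>\<^sub>F n in sequentially. real (max_degree (G n)) \<le> C * real (min_degree (G n))"
  shows "\<exists>K :: nat.
    (\<lambda>n. measure_pmf.prob (load_pmf (G n) n) {X. max_load (G n) X \<le> K}) \<longlonglongrightarrow> 1"
proof -
  \<comment> \<open>Depends on \<open>c\<close> and \<open>C\<close> alone; the \<open>Suc\<close>
    makes it positive. It is both the number of phases and the load bound, as each phase adds at
    most one level.\<close>
  define J where "J = Suc (nat \<lceil>2 * c * (exp (6 / c) - 1) * C * (1 + 2 * C)\<rceil>)"
  have J: "2 * c * (exp (6 / c) - 1) * C * (1 + 2 * C) \<le> real J" "0 < J"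
    unfolding J_def by linarith+
  have "(\<lambda>n. measure_pmf.prob (load_pmf (G n) n) {X. max_load (G n) X \<le> J}) \<longlonglongrightarrow> 1"
  proof (rule tendsto_sandwich)
    show "\<forall>\<^sub>F n in sequentially.
        1 - real J / n \<le> measure_pmf.prob (load_pmf (G n) n) {X. max_load (G n) X \<le> J}"
      using assms(6,7) eventually_ge_at_top[of "J + 2"]
    proof eventually_elim
      case (elim n)
      then show ?case
        using assms(1,3)[of n] assms(4,5) J by (intro prob_max_load_ge) auto
    qed
    show "(\<lambda>n. 1 - real J / real n) \<longlonglongrightarrow> 1"
      using tendsto_diff[OF tendsto_const lim_const_over_n, of 1 "real J"] by simp
  qed auto
  then show ?thesis by blast
qed

end
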